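(* For the path $P_n$ on $n\ge 1$ vertices, $\operatorname{th}_{\rm pd}^{\times}(P_n)=\left\lceil\frac n3\right\rceil$. For the cycle $C_n$ on $n\ge 3$ vertices, $\operatorname{th}_{\rm pd}^{\times}(C_n)=\left\lceil\frac n3\right\rceil$. (In both cases this value equals the domination number of the graph.)
   Context: Let $G$ be a finite simple undirected graph. $N[S]$ denotes the closed neighborhood of $S\subseteq V(G)$; the domination number is the minimum $|S|$ with $N[S]=V(G)$. For nonempty $S\subseteq V(G)$ define $P^{[0]}(S)=S$, $P^{[1]}(S)=N[S]$, and for $i\ge 1$, $P^{[i+1]}(S)=P^{[i]}(S)\cup\{w\in V(G)\setminus P^{[i]}(S): \exists u\in P^{[i]}(S),\ N(u)\setminus P^{[i]}(S)=\{w\}\}$. $S$ is a power dominating set if $P^{[t]}(S)=V(G)$ for some $t$. The power propagation time $\operatorname{pt}_{\rm pd}(G;S)$ is the least positive integer $t$ with $P^{[t]}(S)=V(G)$ (so it is at least $1$, even for $S=V(G)$), and is $\infty$ if $S$ is not a power dominating set. The product power throttling number is $\operatorname{th}_{\rm pd}^{\times}(G)=\min_{\emptyset\ne S\subseteq V(G)}|S|\operatorname{pt}_{\rm pd}(G;S)$. *)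

theory Defs
  imports Complex_Main "HOL-Library.Extended_Nat" "Graph_Theory.Pair_Digraph"
begin

text \<open>
  A finite simple undirected graph is a \<^locale>\<open>pair_graph\<close>: finitely many vertices and a
  symmetric, loop-free set of arcs, so that an edge \<open>uv\<close> is the pair of arcs \<open>(u,v)\<close>, \<open>(v,u)\<close>.
\<close>

definition nbhd :: "'a pair_pre_digraph \<Rightarrow> 'a \<Rightarrow> 'a set" where
  "nbhd G u = {v \<in> pverts G. (u, v) \<in> parcs G}"

definition closed_nbhd :: "'a pair_pre_digraph \<Rightarrow> 'a set \<Rightarrow> 'a set" where
  "closed_nbhd G S = S \<union> (\<Union>u\<in>S. nbhd G u)"

text \<open>The minimum is over a finite nonempty set whenever \<open>G\<close> is finite.\<close>

definition domination_number :: "'a pair_pre_digraph \<Rightarrow> nat" where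
  "domination_number G = Min {card S |S. S \<subseteq> pverts G \<and> closed_nbhd G S = pverts G}"

fun pd_prop :: "'a pair_pre_digraph \<Rightarrow> 'a set \<Rightarrow> nat \<Rightarrow> 'a set" where
  "pd_prop G S 0 = S"
| "pd_prop G S (Suc 0) = closed_nbhd G S"
| "pd_prop G S (Suc (Suc i)) = pd_prop G S (Suc i) \<union>
     {w \<in> pverts G - pd_prop G S (Suc i).
        \<exists>u \<in> pd_prop G S (Suc i). nbhd G u - pd_prop G S (Suc i) = {w}}"

definition power_dominating :: "'a pair_pre_digraph \<Rightarrow> 'a set \<Rightarrow> bool" where
  "power_dominating G S \<longleftrightarrow> (\<exists>t. pd_prop G S t = pverts G)"

text \<open>
  If \<open>S \<subseteq> pverts G\<close> is power dominating then some positive \<open>t\<close> qualifies, since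
  \<open>pd_prop G S 0 = pverts G\<close> implies \<open>pd_prop G S 1 = pverts G\<close>; so \<open>LEAST\<close> is well defined.
\<close>

definition pt_pd :: "'a pair_pre_digraph \<Rightarrow> 'a set \<Rightarrow> enat" where
  "pt_pd G S = (if power_dominating G S
     then enat (LEAST t. t \<ge> 1 \<and> pd_prop G S t = pverts G) else \<infinity>)"

definition th_pd_prod :: "'a pair_pre_digraph \<Rightarrow> enat" where
  "th_pd_prod G = Min {enat (card S) * pt_pd G S |S. S \<noteq> {} \<and> S \<subseteq> pverts G}"

definition path_graph :: "nat \<Rightarrow> nat pair_pre_digraph" where
  "path_graph n = \<lparr> pverts = {0..<n},
     parcs = {(i, j). i < n \<and> j < n \<and> (j = i + 1 \<or> i = j + 1)} \<rparr>"

text \<open>A cycle only for \<open>n \<ge> 3\<close>; \<open>n = 1\<close> gives a loop and \<open>n = 2\<close> a single edge.\<close>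

definition cycle_graph :: "nat \<Rightarrow> nat pair_pre_digraph" where
  "cycle_graph n = \<lparr> pverts = {0..<n},
     parcs = {(i, j). i < n \<and> j < n \<and> (j = (i + 1) mod n \<or> i = (j + 1) mod n)} \<rparr>"

lemma pair_graph_path_graph: "pair_graph (path_graph n)"
proof
  show "finite (parcs (path_graph n))"
    by (rule finite_subset[of _ "{0..<n} \<times> {0..<n}"]) (auto simp: path_graph_def)
qed (auto simp: path_graph_def symmetric_def intro!: symI)

lemma pair_graph_cycle_graph:
  assumes "n \<ge> 3"
  shows "pair_graph (cycle_graph n)"
proof
  show "finite (parcs (cycle_graph n))"
    by (rule finite_subset[of _ "{0..<n} \<times> {0..<n}"]) (auto simp: cycle_graph_def)
  have "(i + 1) mod n \<noteq> i" if "i < n" for i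
    using that assms by (cases "i + 1 = n") auto
  then show "fst e \<noteq> snd e" if "e \<in> parcs (cycle_graph n)" for e
    using that by (auto simp: cycle_graph_def) (metis Suc_eq_plus1)+
qed (auto simp: cycle_graph_def symmetric_def intro!: symI)

end

(* On a path or a cycle, propagation moves at most one step per round, and a ball of radius t has at
   most 2t+1 vertices, so after t rounds at most (2t+1)|S| vertices are observed. As
   2t + 1 \<le> 3t for t \<ge> 1, a power dominating set S with propagation time t satisfies
   n \<le> 3t|S|. Equality up to rounding is attained at t = 1 by a dominating set that takes every
   third vertex. *)

theory Submission
  imports Defs
begin

text \<open>Reduces every comparison with the ceiling to an inequality between natural numbers, the
  form that the counting argument delivers.\<close>

lemma nat_ceiling_third_le_iff: "nat \<lceil>real n / 3\<rceil> \<le> k \<longleftrightarrow> n \<le> 3 * k"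
  by (simp add: nat_le_iff ceiling_le_iff) linarith

(* Treats the path and the cycle simultaneously: a subgraph of the cycle containing the path. *)
locale path_like =
  fixes G :: "nat pair_pre_digraph" and n :: nat
  assumes pos: "n \<ge> 1"
    and verts: "pverts G = {0..<n}"
    and arcs_near: "(u, v) \<in> parcs G \<Longrightarrow> v < n \<Longrightarrow>
      \<exists>d \<in> {-1, 1}. int v = (int u + d) mod int n"
    and arc_up: "Suc u < n \<Longrightarrow> (u, Suc u) \<in> parcs G"
    and arc_down: "Suc u < n \<Longrightarrow> (Suc u, u) \<in> parcs G"
begin

text \<open>A ball in the cycle; it also contains the corresponding ball of the path. Integer
  offsets avoid truncated subtraction. Since only an upper bound on the size is used, offsets that
  coincide modulo \<open>n\<close> do no harm.\<close>

definition cyc_ball :: "nat \<Rightarrow> nat \<Rightarrow> nat set" where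
  "cyc_ball t s = (\<lambda>d. nat ((int s + d) mod int n)) ` {- int t..int t}"

lemma card_cyc_ball_le: "card (cyc_ball t s) \<le> 2 * t + 1"
proof -
  have "card (cyc_ball t s) \<le> card {- int t..int t}"
    unfolding cyc_ball_def by (rule card_image_le) simp
  then show ?thesis by simp
qed

lemma cyc_ball_mono: "t \<le> t' \<Longrightarrow> cyc_ball t s \<subseteq> cyc_ball t' s"
  unfolding cyc_ball_def by (rule image_mono) auto

lemma self_in_cyc_ball:
  assumes "s < n"
  shows "s \<in> cyc_ball t s"
  unfolding cyc_ball_def by (rule image_eqI[of _ _ 0]) (use assms in auto)

lemma nbhd_subset_cyc_ball:
  assumes "u \<in> cyc_ball t s"
  shows "nbhd G u \<subseteq> cyc_ball (Suc t) s"
proof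
  fix v assume "v \<in> nbhd G u"
  then have "(u, v) \<in> parcs G" "v < n"
    by (auto simp: nbhd_def verts)
  then obtain d where d: "d \<in> {-1, 1}" "int v = (int u + d) mod int n"
    using arcs_near by blast
  obtain e where e: "e \<in> {- int t..int t}" "u = nat ((int s + e) mod int n)"
    using assms by (auto simp: cyc_ball_def)
  \<comment> \<open>Offsets add modulo \<open>n\<close>. By \<open>pos\<close> the residue is
    nonnegative, so \<open>nat\<close> in the formula for \<open>u\<close> loses nothing.\<close>
  have "int v = (int s + (e + d)) mod int n"
    using d(2) e(2) pos by (simp add: mod_add_left_eq add.assoc)
  then have "v = nat ((int s + (e + d)) mod int n)"
    by linarith
  moreover have "e + d \<in> {- int (Suc t)..int (Suc t)}"
    using d e by auto
  ultimately show "v \<in> cyc_ball (Suc t) s"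
    unfolding cyc_ball_def by (rule image_eqI)
qed

text \<open>A forced vertex is a neighbour of the vertex forcing it. Forgetting that it must be the
  only unobserved one treats the domination round and the forcing rounds alike.\<close>

lemma pd_prop_Suc_subset: "pd_prop G S (Suc t) \<subseteq> pd_prop G S t \<union> (\<Union>u\<in>pd_prop G S t. nbhd G u)"
  by (cases t) (auto simp: closed_nbhd_def)

lemma pd_prop_subset_cyc_balls:
  assumes "S \<subseteq> pverts G"
  shows "pd_prop G S t \<subseteq> (\<Union>s\<in>S. cyc_ball t s)"
proof (induction t)
  case 0
  have "s \<in> cyc_ball 0 s" if "s \<in> S" for s
    using that assms verts by (intro self_in_cyc_ball) auto
  then show ?case by auto
next
  case (Suc t)
  have "v \<in> (\<Union>s\<in>S. cyc_ball (Suc t) s)"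
    if u: "u \<in> pd_prop G S t" and v: "v = u \<or> v \<in> nbhd G u" for u v
  proof -
    obtain s where "s \<in> S" "u \<in> cyc_ball t s" using Suc.IH u by blast
    moreover have "cyc_ball t s \<subseteq> cyc_ball (Suc t) s" by (rule cyc_ball_mono) simp
    ultimately have "s \<in> S" "v \<in> cyc_ball (Suc t) s"
      using v nbhd_subset_cyc_ball by blast+
    then show ?thesis by blast
  qed
  then have "pd_prop G S t \<union> (\<Union>u\<in>pd_prop G S t. nbhd G u) \<subseteq> (\<Union>s\<in>S. cyc_ball (Suc t) s)"
    by (intro subsetI) (elim UnE UN_E, iprover+)
  with pd_prop_Suc_subset show ?case by (rule subset_trans)
qed

text \<open>Union bound over the balls around \<open>S\<close>. The case t = 1 also bounds
  dominating sets from below, because \<open>pd_prop G S 1\<close> is the closed neighbourhood of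
  \<open>S\<close>.\<close>

lemma order_le_card_mult_time:
  assumes S: "S \<subseteq> pverts G" and t: "t \<ge> 1" and eq: "pd_prop G S t = pverts G"
  shows "n \<le> 3 * (card S * t)"
proof -
  have fin: "finite S" using S verts finite_subset by auto
  have "n = card (pd_prop G S t)" by (simp add: eq verts)
  also have "\<dots> \<le> card (\<Union>s\<in>S. cyc_ball t s)"
    using fin by (intro card_mono pd_prop_subset_cyc_balls S) (auto simp: cyc_ball_def)
  also have "\<dots> \<le> (\<Sum>s\<in>S. card (cyc_ball t s))"
    by (rule card_UN_le[OF fin])
  also have "\<dots> \<le> card S * (2 * t + 1)"
    using sum_bounded_above[of S "\<lambda>s. card (cyc_ball t s)" "2 * t + 1"] card_cyc_ball_le by simp
  also have "\<dots> \<le> card S * (3 * t)"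
    using t by (intro mult_le_mono2) simp
  finally show ?thesis by (simp add: mult_ac)
qed

lemma ex_small_dominating_set:
  obtains S where "S \<subseteq> pverts G" "S \<noteq> {}" "closed_nbhd G S = pverts G"
    "card S = nat \<lceil>real n / 3\<rceil>"
proof -
  let ?m = "nat \<lceil>real n / 3\<rceil>"
  \<comment> \<open>The middle of the k-th block of three consecutive vertices. The minimum matters
    only if the last block is a single vertex, which is then its own centre. Domination uses path
    arcs only, so the same set serves the cycle.\<close>
  define c where "c k = min (3 * k + 1) (n - 1)" for k
  define S where "S = c ` {..<?m}"
  have sub: "S \<subseteq> pverts G"
    using pos by (auto simp: S_def c_def verts)
  have n_le: "n \<le> 3 * ?m"
    using nat_ceiling_third_le_iff by blast
  have dom: "v \<in> closed_nbhd G S" if v: "v < n" for v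
  proof -
    have "v div 3 < ?m" using v n_le by linarith
    then have cS: "c (v div 3) \<in> S" by (simp add: S_def)
    have "v = c k \<or> v = Suc (c k) \<or> Suc v = c k"
      if "v = 3 * k \<or> v = 3 * k + 1 \<or> v = 3 * k + 2" for k
      using that v by (auto simp: c_def min_def)
    moreover have "v = 3 * (v div 3) \<or> v = 3 * (v div 3) + 1 \<or> v = 3 * (v div 3) + 2"
      by presburger
    ultimately have "v = c (v div 3) \<or> v = Suc (c (v div 3)) \<or> Suc v = c (v div 3)"
      by blast
    then have "v = c (v div 3) \<or> v \<in> nbhd G (c (v div 3))"
    proof (elim disjE)
      assume "v = Suc (c (v div 3))"
      then show ?thesis using arc_up[of "c (v div 3)"] v by (auto simp: nbhd_def verts)
    next
      assume "Suc v = c (v div 3)"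
      moreover have "c (v div 3) < n" using cS sub verts by auto
      ultimately show ?thesis using arc_down[of v] v by (auto simp: nbhd_def verts)
    qed simp
    then show ?thesis using cS by (auto simp: closed_nbhd_def)
  qed
  have closed: "closed_nbhd G S = pverts G"
  proof
    show "closed_nbhd G S \<subseteq> pverts G"
      using sub by (auto simp: closed_nbhd_def nbhd_def)
    show "pverts G \<subseteq> closed_nbhd G S"
      using dom by (auto simp: verts)
  qed
  have "card S \<le> ?m"
    unfolding S_def using card_image_le[of "{..<?m}" c] by simp
  \<comment> \<open>The general lower bound at t = 1 replaces a proof that \<open>c\<close> is
    injective.\<close>
  moreover have "?m \<le> card S"
    using order_le_card_mult_time[OF sub, of 1] closed
    unfolding nat_ceiling_third_le_iff by simp
  moreover have "S \<noteq> {}" using dom[of 0] pos by (auto simp: closed_nbhd_def)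
  ultimately show thesis using that sub closed by simp
qed

lemma domination_number_eq: "domination_number G = nat \<lceil>real n / 3\<rceil>"
  unfolding domination_number_def
proof (rule Min_eqI)
  have "{card S |S. S \<subseteq> pverts G \<and> closed_nbhd G S = pverts G} \<subseteq> card ` Pow (pverts G)"
    by auto
  then show "finite {card S |S. S \<subseteq> pverts G \<and> closed_nbhd G S = pverts G}"
    by (rule finite_subset) (simp add: verts)
next
  fix k assume "k \<in> {card S |S. S \<subseteq> pverts G \<and> closed_nbhd G S = pverts G}"
  then show "nat \<lceil>real n / 3\<rceil> \<le> k"
    unfolding nat_ceiling_third_le_iff using order_le_card_mult_time[of _ 1] by auto
next
  show "nat \<lceil>real n / 3\<rceil> \<in> {card S |S. S \<subseteq> pverts G \<and> closed_nbhd G S = pverts G}"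
    by (rule ex_small_dominating_set) (metis (mono_tags, lifting) mem_Collect_eq)
qed

lemma th_pd_prod_eq: "th_pd_prod G = enat (nat \<lceil>real n / 3\<rceil>)"
  unfolding th_pd_prod_def
proof (rule Min_eqI)
  have "{enat (card S) * pt_pd G S |S. S \<noteq> {} \<and> S \<subseteq> pverts G}
      \<subseteq> (\<lambda>S. enat (card S) * pt_pd G S) ` Pow (pverts G)"
    by auto
  then show "finite {enat (card S) * pt_pd G S |S. S \<noteq> {} \<and> S \<subseteq> pverts G}"
    by (rule finite_subset) (simp add: verts)
next
  fix k assume "k \<in> {enat (card S) * pt_pd G S |S. S \<noteq> {} \<and> S \<subseteq> pverts G}"
  then obtain S where S: "S \<noteq> {}" "S \<subseteq> pverts G" and k: "k = enat (card S) * pt_pd G S"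
    by blast
  show "enat (nat \<lceil>real n / 3\<rceil>) \<le> k"
  proof (cases "power_dominating G S")
    case False
    \<comment> \<open>In \<open>enat\<close> the product of 0 and infinity is 0, so the factor must
      be nonzero for \<open>k\<close> to be infinite.\<close>
    have "card S \<noteq> 0" using S verts finite_subset by fastforce
    then show ?thesis using k False by (simp add: pt_pd_def enat_0_iff imult_is_infinity)
  next
    case True
    define t where "t = (LEAST t. t \<ge> 1 \<and> pd_prop G S t = pverts G)"
    obtain t0 where t0: "pd_prop G S t0 = pverts G"
      using True unfolding power_dominating_def by blast
    have "\<exists>t. t \<ge> 1 \<and> pd_prop G S t = pverts G"
    proof (cases t0)
      \<comment> \<open>Here \<open>S\<close> is the whole vertex set, and the least positive time
        is sought, so round 1 has to be checked as well.\<close>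
      case 0
      then have "pd_prop G S 1 = pverts G"
        using t0 by (auto simp: closed_nbhd_def nbhd_def)
      then show ?thesis by blast
    qed (use t0 in force)
    then have "t \<ge> 1 \<and> pd_prop G S t = pverts G"
      unfolding t_def by (rule LeastI_ex)
    then have "n \<le> 3 * (card S * t)" using order_le_card_mult_time S by blast
    moreover have "k = enat (card S * t)"
      using k True by (simp add: pt_pd_def t_def)
    ultimately show ?thesis using nat_ceiling_third_le_iff by (simp only: enat_ord_simps)
  qed
next
  obtain S where S: "S \<subseteq> pverts G" "S \<noteq> {}" "closed_nbhd G S = pverts G"
    "card S = nat \<lceil>real n / 3\<rceil>"
    by (rule ex_small_dominating_set)
  have one: "pd_prop G S 1 = pverts G" using S by simp
  then have "power_dominating G S" unfolding power_dominating_def by blast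
  moreover have "(LEAST t. t \<ge> 1 \<and> pd_prop G S t = pverts G) = 1"
    by (rule Least_equality) (use one in auto)
  ultimately have "pt_pd G S = 1" by (simp add: pt_pd_def one_enat_def)
  then have "enat (nat \<lceil>real n / 3\<rceil>) = enat (card S) * pt_pd G S" using S by simp
  then show "enat (nat \<lceil>real n / 3\<rceil>)
      \<in> {enat (card S) * pt_pd G S |S. S \<noteq> {} \<and> S \<subseteq> pverts G}"
    using S by blast
qed

end

lemma path_like_path_graph:
  assumes "n \<ge> 1"
  shows "path_like (path_graph n) n"
proof
  fix u v assume "(u, v) \<in> parcs (path_graph n)"
  \<comment> \<open>A path arc never wraps around: its endpoints lie below \<open>n\<close>, so the
    reduction changes nothing.\<close>
  then have "int v = (int u + 1) mod int n \<or> int v = (int u + - 1) mod int n"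
    by (auto simp: path_graph_def)
  then show "\<exists>d \<in> {-1, 1}. int v = (int u + d) mod int n" by blast
qed (use assms in \<open>simp_all add: path_graph_def\<close>)

lemma path_like_cycle_graph:
  assumes "n \<ge> 1"
  shows "path_like (cycle_graph n) n"
proof
  fix u v assume "(u, v) \<in> parcs (cycle_graph n)" and v: "v < n"
  then consider "v = (u + 1) mod n" | "u = (v + 1) mod n"
    by (auto simp: cycle_graph_def)
  then show "\<exists>d \<in> {-1, 1}. int v = (int u + d) mod int n"
  proof cases
    case 1
    then have "int v = (int u + 1) mod int n" by (simp add: zmod_int add.commute)
    then show ?thesis by blast
  next
    case 2
    then have "int u = (int v + 1) mod int n" by (simp add: zmod_int add.commute)
    \<comment> \<open>Subtracting 1 inverts the successor modulo \<open>n\<close>;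
      \<open>v < n\<close> then identifies \<open>v\<close> with its residue.\<close>
    then have "(int u + - 1) mod int n = (int v + 1 + - 1) mod int n"
      by (simp only: mod_add_left_eq)
    then have "int v = (int u + - 1) mod int n" using v by simp
    then show ?thesis by blast
  qed
qed (use assms in \<open>simp_all add: cycle_graph_def\<close>)

theorem mainTheorem5:
  shows "(\<forall>n::nat. n \<ge> 1 \<longrightarrow>
           th_pd_prod (path_graph n) = enat (nat \<lceil>real n / 3\<rceil>) \<and>
           domination_number (path_graph n) = nat \<lceil>real n / 3\<rceil>) \<and>
         (\<forall>n::nat. n \<ge> 3 \<longrightarrow>
           th_pd_prod (cycle_graph n) = enat (nat \<lceil>real n / 3\<rceil>) \<and>
           domination_number (cycle_graph n) = nat \<lceil>real n / 3\<rceil>)"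
  by (simp add: path_like.th_pd_prod_eq[OF path_like_path_graph]
      path_like.domination_number_eq[OF path_like_path_graph]
      path_like.th_pd_prod_eq[OF path_like_cycle_graph]
      path_like.domination_number_eq[OF path_like_cycle_graph])

end
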